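(* Let $\beta,\lambda>0$, and let $\Gamma\subset\mathbb R$ be a separated set with lower Beurling density $D^-(\Gamma)>2\beta^{-1}$. Let $f(x)=\sum_{k\in\mathbb Z}c_ke^{-\lambda(x-\beta k)^2}$ with $\{c_k\}\in\ell^\infty(\mathbb Z)$ and $\{kc_k\}\in\ell^\infty(\mathbb Z)$. Then $f$ is uniquely determined, up to a unimodular constant and conjugation, by its phaseless Hermite samples $|f(\gamma)|,|f'(\gamma)|$, $\gamma\in\Gamma$: that is, if $g(x)=\sum_{k\in\mathbb Z}d_ke^{-\lambda(x-\beta k)^2}$ with $\{d_k\}\in\ell^\infty(\mathbb Z)$, $\{kd_k\}\in\ell^\infty(\mathbb Z)$ satisfies $|g(\gamma)|=|f(\gamma)|$ and $|g'(\gamma)|=|f'(\gamma)|$ for all $\gamma\in\Gamma$, then there is $z\in\mathbb C$ with $|z|=1$ such that $g=zf$ or $g=z\overline{f}$.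
   Context: A set $\Gamma\subset\mathbb R$ is separated if $\inf\{|\gamma-\gamma'|:\gamma\neq\gamma'\in\Gamma\}>0$. The lower Beurling density is $D^-(\Gamma)=\liminf_{r\to\infty}\inf_{x\in\mathbb R}\frac{\#(\Gamma\cap[x-r,x+r])}{2r}$. *)

theory Defs
  imports "HOL-Analysis.Analysis"
begin

definition separated :: "real set \<Rightarrow> bool" where
  "separated \<Gamma> \<longleftrightarrow> (\<exists>\<delta>>0. \<forall>\<gamma>\<in>\<Gamma>. \<forall>\<gamma>'\<in>\<Gamma>. \<gamma> \<noteq> \<gamma>' \<longrightarrow> \<delta> \<le> \<bar>\<gamma> - \<gamma>'\<bar>)"

definition lower_beurling_density :: "real set \<Rightarrow> ereal" where
  "lower_beurling_density \<Gamma> =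
     Liminf at_top (\<lambda>r::real. INF x\<in>(UNIV::real set).
        ereal (real (card (\<Gamma> \<inter> {x - r..x + r})) / (2 * r)))"

definition gauss_series :: "real \<Rightarrow> real \<Rightarrow> (int \<Rightarrow> complex) \<Rightarrow> real \<Rightarrow> complex" where
  "gauss_series lam \<beta> c x = (\<Sum>\<^sub>\<infinity>k\<in>(UNIV::int set). c k * complex_of_real (exp (- lam * (x - \<beta> * real_of_int k)\<^sup>2)))"

definition bounded_seq :: "(int \<Rightarrow> complex) \<Rightarrow> bool" where
  "bounded_seq c \<longleftrightarrow> (\<exists>M. \<forall>k. norm (c k) \<le> M)"

end

theory Submission
  imports Defs "HOL-Complex_Analysis.Complex_Analysis" "HOL-Real_Asymp.Real_Asymp"
begin

text \<open>
  Put \<open>a = \<lambda>\<beta>\<^sup>2\<close> and \<open>w = exp (2\<lambda>\<beta>x)\<close>. Then \<open>f x = exp (-\<lambda>x\<^sup>2) L w\<close>, where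
  \<open>L w = \<Sum>k. c\<^sub>k exp (-ak\<^sup>2) w\<^sup>k\<close> is holomorphic on the punctured plane and bounded by a multiple of
  \<open>exp ((ln \<bar>w\<bar>)\<^sup>2 / (4a))\<close>. With \<open>L\<^sup>*\<close> the series of the conjugate coefficients, the difference of the
  products \<open>L L\<^sup>*\<close> for \<open>f\<close> and \<open>g\<close> vanishes at the points \<open>exp (2\<lambda>\<beta>\<gamma>)\<close>. There are too many of these
  for its growth: divide by the factors \<open>1 - w/w\<^sub>\<gamma>\<close> for \<open>\<gamma> > 0\<close> and \<open>1 - w\<^sub>\<gamma>/w\<close> for \<open>\<gamma> < 0\<close> and apply
  the maximum principle on the annuli \<open>exp (-S) < \<bar>w\<bar> < exp S\<close>; as \<open>S\<close> grows, the quotient, and with it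
  the function, is forced to be 0. Hence \<open>\<bar>f\<bar> = \<bar>g\<bar>\<close> on the real line. Differentiating this identity
  removes the cross term \<open>2 Re (f \<cdot> cnj h)\<close> from \<open>\<bar>f'\<bar>\<^sup>2\<close>, where \<open>h\<close> is the series with the coefficients
  \<open>k c\<^sub>k\<close>, so that the same uniqueness argument applies to \<open>\<bar>h\<bar>\<^sup>2\<close> and gives \<open>\<bar>f'\<bar> = \<bar>g'\<bar>\<close> everywhere.
  Finally, for the logarithmic derivatives the sum and the product of \<open>f'/f\<close> and \<open>f\<^sup>*'/f\<^sup>*\<close> agree with
  those of \<open>g'/g\<close> and \<open>g\<^sup>*'/g\<^sup>*\<close>, so \<open>g'/g\<close> is one of \<open>f'/f\<close> and \<open>f\<^sup>*'/f\<^sup>*\<close>.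
\<close>

section \<open>Holomorphic functions on the punctured plane with many zeros\<close>

text \<open>The zeros are split off one at a time. The quotient \<open>q\<close> obtained so far
  still vanishes at the new point \<open>a\<close>, because the factors already removed are nonzero
  there, so \<open>q w / (w - a)\<close> has a removable singularity at \<open>a\<close>.\<close>

lemma holomorphic_factor_zeros:
  fixes f :: "complex \<Rightarrow> complex"
  assumes "finite A" "open S" "f holomorphic_on S" "A \<subseteq> S" "\<And>a. a \<in> A \<Longrightarrow> f a = 0"
  shows "\<exists>q. q holomorphic_on S \<and> (\<forall>w\<in>S. f w = q w * (\<Prod>a\<in>A. w - a))"
  using assms(1,4,5)
proof (induction A rule: finite_induct)
  case empty
  then show ?case using assms(3) by auto
next
  case (insert a A)
  then obtain q where q: "q holomorphic_on S" "\<And>w. w \<in> S \<Longrightarrow> f w = q w * (\<Prod>b\<in>A. w - b)"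
    by auto
  have "(\<Prod>b\<in>A. a - b) \<noteq> 0"
    using insert.hyps by auto
  moreover have "q a * (\<Prod>b\<in>A. a - b) = 0"
    using q(2)[of a] insert.prems by simp
  ultimately have "q a = 0" by simp
  define r where "r w = (if w = a then deriv q a else (q w - q a) / (w - a))" for w
  have "r holomorphic_on S"
    unfolding r_def by (rule pole_lemma_open[OF q(1) assms(2)])
  moreover have "f w = r w * (\<Prod>b\<in>insert a A. w - b)" if "w \<in> S" for w
  proof -
    have "q w = r w * (w - a)"
      using \<open>q a = 0\<close> by (simp add: r_def)
    then show ?thesis
      using q(2)[OF that] insert.hyps by (simp add: mult_ac)
  qed
  ultimately show ?case by blast
qed

section \<open>Finite products over blocks of zeros\<close>

lemma prod_UNION_blocks_ge:
  fixes g :: "'a \<Rightarrow> real" and h :: "nat \<Rightarrow> real"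
  assumes A: "\<And>i. i < J \<Longrightarrow> finite (A i) \<and> card (A i) = N"
    and disj: "\<And>i j. i < J \<Longrightarrow> j < J \<Longrightarrow> i \<noteq> j \<Longrightarrow> A i \<inter> A j = {}"
    and gh: "\<And>i x. i < J \<Longrightarrow> x \<in> A i \<Longrightarrow> h i \<le> g x"
    and h0: "\<And>i. i < J \<Longrightarrow> 0 \<le> h i"
  shows "(\<Prod>i<J. h i ^ N) \<le> (\<Prod>x\<in>(\<Union>i<J. A i). g x)"
proof -
  have "(\<Prod>x\<in>(\<Union>i<J. A i). g x) = (\<Prod>i<J. \<Prod>x\<in>A i. g x)"
    using A disj by (intro prod.UNION_disjoint) auto
  moreover have "h i ^ N \<le> (\<Prod>x\<in>A i. g x)" if "i < J" for i
  proof -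
    have "(\<Prod>x\<in>A i. h i) \<le> (\<Prod>x\<in>A i. g x)"
      using gh[OF that] h0[OF that] by (intro prod_mono) auto
    then show ?thesis using A[OF that] by simp
  qed
  ultimately show ?thesis
    using h0 by (auto intro!: prod_mono)
qed

text \<open>The factors are normalised to be 1 at \<open>w = 0\<close>. Evaluated at
  \<open>1 / w\<close>, the same product has its zeros at the points
  \<open>exp (- \<tau> * \<gamma>)\<close>, which accumulate at 0 instead of infinity.\<close>

definition zero_prod :: "real \<Rightarrow> real set \<Rightarrow> complex \<Rightarrow> complex" where
  "zero_prod \<tau> G w = (\<Prod>\<gamma>\<in>G. 1 - w * of_real (exp (- \<tau> * \<gamma>)))"

text \<open>Linear factors are rescaled to normalised ones:
  \<open>w - e \<gamma> = - e \<gamma> * (1 - w / e \<gamma>)\<close> for the zeros outside the unit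
  circle, and \<open>w - e (- \<gamma>) = w * (1 - e (- \<gamma>) / w)\<close> for those inside. The
  multipliers \<open>c\<close> and \<open>w ^ card H\<close> are absorbed into the quotient.
  Positivity of the exponents keeps the two families of zeros disjoint.\<close>

lemma holomorphic_factor_zero_prod:
  assumes F: "F holomorphic_on - {0}" and fin: "finite G" "finite H"
    and pos: "\<And>\<gamma>. \<gamma> \<in> G \<union> H \<Longrightarrow> 0 < \<gamma>" and "\<tau> > 0"
    and G: "\<And>\<gamma>. \<gamma> \<in> G \<Longrightarrow> F (of_real (exp (\<tau> * \<gamma>))) = 0"
    and H: "\<And>\<gamma>. \<gamma> \<in> H \<Longrightarrow> F (of_real (exp (- \<tau> * \<gamma>))) = 0"
  obtains q where "q holomorphic_on - {0}"
    and "\<And>w. w \<noteq> 0 \<Longrightarrow> F w = q w * (zero_prod \<tau> G w * zero_prod \<tau> H (1 / w))"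
proof -
  define e :: "real \<Rightarrow> complex" where "e \<gamma> = of_real (exp (\<tau> * \<gamma>))" for \<gamma>
  have enz: "e \<gamma> \<noteq> 0" for \<gamma> by (simp add: e_def)
  have einv: "of_real (exp (- \<tau> * \<gamma>)) = 1 / e \<gamma>" "of_real (exp (- \<tau> * \<gamma>)) = e (- \<gamma>)" for \<gamma>
    by (simp_all add: e_def exp_minus field_simps)
  have inj: "inj_on e X" for X
    using \<open>\<tau> > 0\<close> by (auto simp: inj_on_def e_def)
  have injm: "inj_on (\<lambda>\<gamma>. e (- \<gamma>)) X" for X
    using \<open>\<tau> > 0\<close> by (auto simp: inj_on_def e_def)
  let ?M = "(\<lambda>\<gamma>. e (- \<gamma>)) ` H"
  have disj: "e ` G \<inter> ?M = {}"
  proof -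
    have "e x \<noteq> e (- y)" if "x \<in> G" "y \<in> H" for x y
    proof
      assume "e x = e (- y)"
      then have "\<tau> * x = \<tau> * (- y)" by (simp add: e_def)
      then have "x = - y" using \<open>\<tau> > 0\<close> by (metis mult_left_cancel less_irrefl)
      then show False using pos[of x] pos[of y] that by auto
    qed
    then show ?thesis by blast
  qed
  have Fe: "F a = 0" if "a \<in> e ` G \<union> ?M" for a
    using that G H by (auto simp: e_def)
  have "e ` G \<union> ?M \<subseteq> - {0}" using enz by force
  with Fe obtain q where q: "q holomorphic_on - {0}"
    "\<And>w. w \<noteq> 0 \<Longrightarrow> F w = q w * (\<Prod>a\<in>e ` G \<union> ?M. w - a)"
    using holomorphic_factor_zeros[of "e ` G \<union> ?M" "- {0}" F] fin F
    by (metis ComplI finite_UnI finite_imageI open_Compl closed_singleton singletonD)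
  define c where "c = (\<Prod>\<gamma>\<in>G. - e \<gamma>)"
  show thesis
  proof
    show "(\<lambda>w. q w * (c * w ^ card H)) holomorphic_on - {0}"
      by (intro holomorphic_intros q)
    fix w :: complex assume w: "w \<noteq> 0"
    have "(\<Prod>a\<in>e ` G. w - a) = c * zero_prod \<tau> G w"
      unfolding c_def zero_prod_def einv(1) prod.reindex[OF inj] prod.distrib[symmetric]
      by (intro prod.cong) (auto simp: enz field_simps)
    moreover have "(\<Prod>a\<in>?M. w - a) = w ^ card H * zero_prod \<tau> H (1 / w)"
      unfolding zero_prod_def einv(2) prod.reindex[OF injm] prod_constant[symmetric] prod.distrib[symmetric]
      by (intro prod.cong) (auto simp: w field_simps)
    moreover have "(\<Prod>a\<in>e ` G \<union> ?M. w - a) = (\<Prod>a\<in>e ` G. w - a) * (\<Prod>a\<in>?M. w - a)"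
      using fin disj by (intro prod.union_disjoint) auto
    ultimately show "F w = q w * (c * w ^ card H) * (zero_prod \<tau> G w * zero_prod \<tau> H (1 / w))"
      using q(2)[OF w] by (simp add: mult_ac)
  qed
qed

lemma norm_zero_prod_le:
  assumes "\<And>\<gamma>. \<gamma> \<in> G \<Longrightarrow> 0 < \<gamma>" "\<tau> > 0"
  shows "norm (zero_prod \<tau> G w) \<le> (1 + norm w) ^ card G"
proof -
  have "norm (zero_prod \<tau> G w) \<le> (\<Prod>\<gamma>\<in>G. 1 + norm w)"
    unfolding zero_prod_def prod_norm[symmetric]
  proof (intro prod_mono conjI norm_ge_zero)
    fix \<gamma> assume "\<gamma> \<in> G"
    have "norm (1 - w * of_real (exp (- \<tau> * \<gamma>))) \<le> 1 + norm w * exp (- \<tau> * \<gamma>)"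
      by (rule order_trans[OF norm_triangle_ineq4]) (simp add: norm_mult)
    also have "\<dots> \<le> 1 + norm w * 1"
      using assms(1)[OF \<open>\<gamma> \<in> G\<close>] assms(2) by (intro add_left_mono mult_left_mono) auto
    finally show "norm (1 - w * of_real (exp (- \<tau> * \<gamma>))) \<le> 1 + norm w" by simp
  qed
  then show ?thesis by simp
qed

text \<open>Each interval of length \<open>m\<close> on the positive half-line supplies exactly
  \<open>N\<close> points. The margin \<open>\<delta>\<close> keeps them away from the end points
  \<open>m * J\<close>, so that the circles of radius \<open>exp (\<tau> * m * J)\<close> stay clear
  of the zeros.\<close>

locale zero_blocks =
  fixes \<tau> m \<delta> :: real and N :: nat and A :: "nat \<Rightarrow> real set"
  assumes \<tau>: "\<tau> > 0" and \<delta>: "\<delta> > 0" and m: "m > 0"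
    and fin: "finite (A i)" and card: "card (A i) = N"
    and block: "A i \<subseteq> {m * i + \<delta>..m * (i + 1) - \<delta>}"
begin

lemma block_pos: "\<gamma> \<in> A i \<Longrightarrow> \<delta> \<le> \<gamma>"
  using block[of i] m by (smt (verit) atLeastAtMost_iff in_mono of_nat_0_le_iff mult_nonneg_nonneg)

lemma blocks_disjoint: "i \<noteq> j \<Longrightarrow> A i \<inter> A j = {}"
proof (induction i j rule: linorder_wlog)
  case (le i j)
  then have "real i + 1 \<le> real j" by simp
  then have "m * (real i + 1) \<le> m * real j" using m by simp
  moreover have "x \<le> m * (real i + 1) - \<delta> \<and> m * real j + \<delta> \<le> x" if "x \<in> A i" "x \<in> A j" for x
    using block[of i] block[of j] that by (auto simp: add.commute)
  ultimately show ?case using \<delta> by (smt (verit) disjoint_iff)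
qed auto

text \<open>Here \<open>norm w \<le> 1\<close> and every exponent is at least
  \<open>\<delta>\<close>, so each factor is within \<open>exp (- \<tau> * \<delta>)\<close> of
  1.\<close>

lemma norm_zero_prod_ge_inner:
  assumes w: "norm w = exp (- \<tau> * m * real J)"
  shows "norm (zero_prod \<tau> (\<Union>i<J. A i) w) \<ge> (1 - exp (- \<tau> * \<delta>)) ^ (J * N)"
proof -
  let ?\<rho> = "1 - exp (- \<tau> * \<delta>)"
  have \<rho>: "0 \<le> ?\<rho>" using \<tau> \<delta> by simp
  have "?\<rho> \<le> norm (1 - w * of_real (exp (- \<tau> * \<gamma>)))" if "\<gamma> \<in> A i" for i \<gamma>
  proof -
    have "norm (w * of_real (exp (- \<tau> * \<gamma>))) = exp (- \<tau> * m * real J - \<tau> * \<gamma>)"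
      unfolding norm_mult w by (simp flip: exp_add)
    also have "\<dots> \<le> exp (- \<tau> * \<delta>)"
    proof -
      have "\<tau> * \<delta> \<le> \<tau> * \<gamma>" "0 \<le> \<tau> * m * real J"
        using block_pos[OF that] \<tau> m by simp_all
      then show ?thesis by simp
    qed
    finally show ?thesis
      using norm_triangle_ineq2[of 1 "w * of_real (exp (- \<tau> * \<gamma>))"] by simp
  qed
  then have "(\<Prod>i<J. ?\<rho> ^ N) \<le> (\<Prod>\<gamma>\<in>(\<Union>i<J. A i). norm (1 - w * of_real (exp (- \<tau> * \<gamma>))))"
    using fin card blocks_disjoint \<rho> by (intro prod_UNION_blocks_ge) auto
  then show ?thesis
    by (simp add: zero_prod_def prod_norm power_mult[symmetric] mult.commute)
qed

text \<open>A factor from block \<open>i\<close> has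
  \<open>norm w * exp (- \<tau> * \<gamma>) = exp t\<close> with \<open>t\<close> at least both
  \<open>\<tau> * \<delta>\<close> and \<open>\<tau> * m * (J - 1 - i)\<close>. The first bound
  gives \<open>exp t - 1 \<ge> (1 - exp (- \<tau> * \<delta>)) * exp t\<close>; the second, summed
  over the blocks, gives the exponent quadratic in \<open>J\<close> that competes with the growth of
  the function.\<close>

lemma norm_zero_prod_ge_outer:
  assumes w: "norm w = exp (\<tau> * m * real J)"
  shows "norm (zero_prod \<tau> (\<Union>i<J. A i) w) \<ge>
    (1 - exp (- \<tau> * \<delta>)) ^ (J * N) * exp (\<tau> * m * N * (real J * (real J - 1) / 2))"
proof -
  let ?\<rho> = "1 - exp (- \<tau> * \<delta>)"
  let ?h = "\<lambda>i. ?\<rho> * exp (\<tau> * m * (real J - 1 - real i))"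
  have \<rho>: "0 \<le> ?\<rho>" using \<tau> \<delta> by simp
  have "?h i \<le> norm (1 - w * of_real (exp (- \<tau> * \<gamma>)))" if "\<gamma> \<in> A i" "i < J" for i \<gamma>
  proof -
    define t where "t = \<tau> * m * real J - \<tau> * \<gamma>"
    have g: "\<gamma> \<le> m * (real i + 1) - \<delta>" using block[of i] that by (auto simp: add.commute)
    have "\<tau> * \<gamma> \<le> \<tau> * (m * (real i + 1) - \<delta>)" using g \<tau> by simp
    then have t: "t \<ge> \<tau> * m * (real J - 1 - real i) + \<tau> * \<delta>"
      by (simp add: t_def algebra_simps)
    have "0 \<le> \<tau> * m * (real J - 1 - real i)" using \<tau> m that(2) by simp
    moreover have "\<tau> * \<delta> > 0" using \<tau> \<delta> by simp
    ultimately have t2: "t \<ge> \<tau> * \<delta>" "t \<ge> \<tau> * m * (real J - 1 - real i)" using t by linarith+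
    have "norm (w * of_real (exp (- \<tau> * \<gamma>))) = exp t"
      unfolding norm_mult w by (simp add: t_def flip: exp_add)
    then have "exp t - 1 \<le> norm (1 - w * of_real (exp (- \<tau> * \<gamma>)))"
      using norm_triangle_ineq2[of "w * of_real (exp (- \<tau> * \<gamma>))" 1] by (simp add: norm_minus_commute)
    moreover have "?\<rho> * exp t \<le> exp t - 1"
    proof -
      have "1 \<le> exp (- \<tau> * \<delta>) * exp t" using t2 by (simp flip: exp_add)
      then show ?thesis by (simp add: algebra_simps)
    qed
    moreover have "?h i \<le> ?\<rho> * exp t"
      using t2 \<rho> by (intro mult_left_mono) auto
    ultimately show ?thesis by linarith
  qed
  then have "(\<Prod>i<J. ?h i ^ N) \<le> (\<Prod>\<gamma>\<in>(\<Union>i<J. A i). norm (1 - w * of_real (exp (- \<tau> * \<gamma>))))"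
    using fin card blocks_disjoint \<rho> by (intro prod_UNION_blocks_ge) auto
  moreover have "(\<Prod>i<J. ?h i ^ N) = ?\<rho> ^ (J * N) * exp (\<tau> * m * N * (\<Sum>i<J. real J - 1 - real i))"
    by (simp add: power_mult_distrib prod.distrib power_mult[symmetric] mult.commute
        exp_of_nat_mult[symmetric] exp_sum[symmetric] sum_distrib_left mult_ac)
  moreover have "(\<Sum>i<J. real J - 1 - real i) = real J * (real J - 1) / 2"
    by (induction J) (auto simp: field_simps sum_subtractf sum.distrib)
  ultimately show ?thesis
    by (simp add: zero_prod_def prod_norm)
qed

end


text \<open>On the circles of radius \<open>exp S\<close> and \<open>exp (- S)\<close> with
  \<open>S = \<tau> * m * J\<close>, the function has size at most
  \<open>C * exp (\<kappa> * S\<^sup>2)\<close>, whereas the zero products have size about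
  \<open>exp (\<tau> * m * N * J\<^sup>2 / 2)\<close>. The density condition says precisely that the
  second exponent wins, so the quotient at a fixed \<open>w\<close> is forced to 0.\<close>

lemma holomorphic_punctured_plane_eq_0:
  assumes F: "F holomorphic_on - {0}"
    and bound: "\<And>w. w \<noteq> 0 \<Longrightarrow> norm (F w) \<le> C * exp (\<kappa> * (ln (norm w))\<^sup>2)"
    and A: "zero_blocks \<tau> m \<delta> N A" and B: "zero_blocks \<tau> m \<delta> N B"
    and zA: "\<And>i \<gamma>. \<gamma> \<in> A i \<Longrightarrow> F (of_real (exp (\<tau> * \<gamma>))) = 0"
    and zB: "\<And>i \<gamma>. \<gamma> \<in> B i \<Longrightarrow> F (of_real (exp (- \<tau> * \<gamma>))) = 0"
    and dens: "2 * \<kappa> * \<tau> * m < N" and w: "w \<noteq> 0"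
  shows "F w = 0"
proof -
  interpret A: zero_blocks \<tau> m \<delta> N A by (rule A)
  interpret B: zero_blocks \<tau> m \<delta> N B by (rule B)
  define \<rho> where "\<rho> = 1 - exp (- \<tau> * \<delta>)"
  have \<rho>: "\<rho> > 0" using A.\<tau> A.\<delta> by (simp add: \<rho>_def)
  \<comment> \<open>\<open>W\<close> bounds a pair of factors, one from each zero product, at the
    fixed point \<open>w\<close>; \<open>a\<close> and \<open>K\<close> are the coefficients of the
    square and of the linear term in \<open>J\<close> of the resulting exponent.\<close>
  define W where "W = (1 + norm w) * (1 + norm (1 / w))"
  have W: "W > 0" by (simp add: W_def add_pos_nonneg)
  define a where "a = \<kappa> * (\<tau> * m)\<^sup>2 - \<tau> * m * N / 2"
  define K where "K = N * ln (W / \<rho>\<^sup>2) + \<tau> * m * N / 2"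
  have "a = (\<tau> * m / 2) * (2 * \<kappa> * \<tau> * m - N)"
    by (simp add: a_def power2_eq_square field_simps)
  moreover have "\<tau> * m / 2 > 0" using A.\<tau> A.m by simp
  ultimately have a: "a < 0"
    using dens by (metis mult_pos_neg diff_less_0_iff_less)
  have key: "norm (F w) \<le> C * exp (a * (real J)\<^sup>2 + K * real J)"
    if J: "\<bar>ln (norm w)\<bar> < \<tau> * m * real J" for J
  proof -
    define S where "S = \<tau> * m * real J"
    define G where "G = (\<Union>i<J. A i)"
    define H where "H = (\<Union>i<J. B i)"
    define E where "E = exp (\<tau> * m * N * (real J * (real J - 1) / 2))"
    \<comment> \<open>On either boundary circle one of the two zero products is estimated from
      outside and the other from inside, so the same lower bound \<open>D\<close> serves both
      circles.\<close>
    define D where "D = \<rho> ^ (J * N) * E * \<rho> ^ (J * N)"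
    have D: "D > 0" using \<rho> by (simp add: D_def E_def)
    have fin: "finite G" "finite H"
      using A.fin B.fin by (auto simp: G_def H_def)
    have cG: "card G \<le> J * N" "card H \<le> J * N"
      unfolding G_def H_def
      using card_UN_le[of "{..<J}" A] card_UN_le[of "{..<J}" B] A.card B.card by auto
    have pos: "0 < \<gamma>" if "\<gamma> \<in> G \<union> H" for \<gamma>
      using that A.block_pos B.block_pos A.\<delta> unfolding G_def H_def by fastforce
    obtain q where q: "q holomorphic_on - {0}"
      and Fq: "\<And>z. z \<noteq> 0 \<Longrightarrow> F z = q z * (zero_prod \<tau> G z * zero_prod \<tau> H (1 / z))"
      using holomorphic_factor_zero_prod[of F G H \<tau>] F fin pos A.\<tau> zA zB
      unfolding G_def H_def by blast
    have qbound: "norm (q z) \<le> C * exp (\<kappa> * S\<^sup>2) / D"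
      if z: "norm z = exp S \<or> norm z = exp (- S)" for z
    proof -
      have z0: "z \<noteq> 0" using z by auto
      have "D \<le> norm (zero_prod \<tau> G z * zero_prod \<tau> H (1 / z))"
        using z
      proof
        assume "norm z = exp S"
        then have "norm z = exp (\<tau> * m * real J)" "norm (1 / z) = exp (- \<tau> * m * real J)"
          by (simp_all add: S_def norm_divide exp_minus field_simps)
        from A.norm_zero_prod_ge_outer[OF this(1)] B.norm_zero_prod_ge_inner[OF this(2)]
        show ?thesis unfolding D_def E_def G_def H_def norm_mult \<rho>_def[symmetric]
          using \<rho> by (intro mult_mono) auto
      next
        assume "norm z = exp (- S)"
        then have "norm z = exp (- \<tau> * m * real J)" "norm (1 / z) = exp (\<tau> * m * real J)"
          by (simp_all add: S_def norm_divide exp_minus inverse_eq_divide)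
        from A.norm_zero_prod_ge_inner[OF this(1)] B.norm_zero_prod_ge_outer[OF this(2)]
        have "\<rho> ^ (J * N) * (\<rho> ^ (J * N) * E) \<le> norm (zero_prod \<tau> G z * zero_prod \<tau> H (1 / z))"
          unfolding E_def G_def H_def norm_mult \<rho>_def[symmetric]
          using \<rho> by (intro mult_mono) auto
        then show ?thesis by (simp add: D_def mult_ac)
      qed
      then have "norm (q z) * D \<le> norm (q z) * norm (zero_prod \<tau> G z * zero_prod \<tau> H (1 / z))"
        by (intro mult_left_mono) auto
      also have "\<dots> = norm (F z)" using Fq[OF z0] by (simp add: norm_mult)
      also have "\<dots> \<le> C * exp (\<kappa> * S\<^sup>2)" using bound[OF z0] z by auto
      finally show ?thesis using D by (simp add: field_simps)
    qed
    \<comment> \<open>A frontier point of the open annulus \<open>U\<close> lies in the closed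
      annulus \<open>V\<close> but not in \<open>U\<close>, hence on one of the two circles where
      \<open>qbound\<close> applies.\<close>
    define U :: "complex set" where "U = {z. exp (- S) < norm z \<and> norm z < exp S}"
    define V :: "complex set" where "V = {z. exp (- S) \<le> norm z \<and> norm z \<le> exp S}"
    have "open U" unfolding U_def by (intro open_Collect_conj open_Collect_less continuous_intros)
    have "closed V" unfolding V_def by (intro closed_Collect_conj closed_Collect_le continuous_intros)
    then have cU: "closure U \<subseteq> V" by (intro closure_minimal) (auto simp: U_def V_def)
    have V0: "V \<subseteq> - {0}" by (auto simp: V_def not_le)
    have "norm (q w) \<le> C * exp (\<kappa> * S\<^sup>2) / D"
    proof (rule maximum_modulus_frontier[of q U])
      show "q holomorphic_on interior U"
        using q by (rule holomorphic_on_subset) (use \<open>open U\<close> in \<open>auto simp: interior_open, simp add: U_def\<close>)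
      show "continuous_on (closure U) q"
        using q cU V0 by (meson continuous_on_subset holomorphic_on_imp_continuous_on order_trans)
      show "bounded U" by (rule boundedI[of _ "exp S"]) (auto simp: U_def)
      show "w \<in> U"
        using J w unfolding U_def S_def[symmetric]
        by (metis (mono_tags, lifting) abs_less_iff exp_ln exp_less_cancel_iff mem_Collect_eq
            minus_less_iff zero_less_norm_iff)
    next
      fix z assume "z \<in> frontier U"
      then have "z \<in> V" "z \<notin> U"
        using cU \<open>open U\<close> by (auto simp: frontier_def interior_open)
      then show "norm (q z) \<le> C * exp (\<kappa> * S\<^sup>2) / D"
        by (intro qbound) (auto simp: U_def V_def)
    qed
    moreover have "norm (zero_prod \<tau> G w * zero_prod \<tau> H (1 / w)) \<le> W ^ (J * N)"
    proof -
      have "norm (zero_prod \<tau> G w) \<le> (1 + norm w) ^ card G"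
        using pos A.\<tau> by (intro norm_zero_prod_le) auto
      also have "\<dots> \<le> (1 + norm w) ^ (J * N)" using cG by (intro power_increasing) auto
      finally have 1: "norm (zero_prod \<tau> G w) \<le> (1 + norm w) ^ (J * N)" .
      have "norm (zero_prod \<tau> H (1 / w)) \<le> (1 + norm (1 / w)) ^ card H"
        using pos A.\<tau> by (intro norm_zero_prod_le) auto
      also have "\<dots> \<le> (1 + norm (1 / w)) ^ (J * N)" using cG by (intro power_increasing) auto
      finally show ?thesis
        unfolding norm_mult W_def power_mult_distrib using 1 by (intro mult_mono) auto
    qed
    ultimately have "norm (F w) \<le> C * exp (\<kappa> * S\<^sup>2) / D * W ^ (J * N)"
      unfolding Fq[OF w] norm_mult[of "q w"] by (intro mult_mono) (auto intro: order_trans[OF norm_ge_zero])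
    also have "\<dots> = C * exp (a * (real J)\<^sup>2 + K * real J)"
    proof -
      have "W ^ (J * N) / (\<rho> ^ (J * N) * \<rho> ^ (J * N)) = (W / \<rho>\<^sup>2) ^ (J * N)"
        by (simp add: power_divide power2_eq_square power_mult_distrib)
      also have "\<dots> = exp (real (J * N) * ln (W / \<rho>\<^sup>2))"
        using W \<rho> by (subst exp_of_nat_mult) simp
      finally have Wr: "W ^ (J * N) / (\<rho> ^ (J * N) * \<rho> ^ (J * N)) = exp (real (J * N) * ln (W / \<rho>\<^sup>2))" .
      have "exp (\<kappa> * S\<^sup>2) / D * W ^ (J * N)
        = exp (\<kappa> * S\<^sup>2) / E * (W ^ (J * N) / (\<rho> ^ (J * N) * \<rho> ^ (J * N)))"
        by (simp add: D_def mult_ac)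
      also have "\<dots>
        = exp (\<kappa> * S\<^sup>2 - \<tau> * m * N * (real J * (real J - 1) / 2) + real (J * N) * ln (W / \<rho>\<^sup>2))"
        unfolding Wr E_def by (simp only: exp_add exp_diff)
      also have "\<kappa> * S\<^sup>2 - \<tau> * m * N * (real J * (real J - 1) / 2) + real (J * N) * ln (W / \<rho>\<^sup>2)
        = a * (real J)\<^sup>2 + K * real J"
        by (simp add: a_def K_def S_def power2_eq_square field_simps)
      finally show ?thesis by (metis mult.assoc times_divide_eq_right)
    qed
    finally show ?thesis .
  qed
  \<comment> \<open>Since \<open>a < 0\<close>, the bound tends to 0 as \<open>J\<close> grows,
    while \<open>w\<close> stays fixed and eventually lies in every annulus.\<close>
  have "(\<lambda>J. C * exp (a * (real J)\<^sup>2 + K * real J)) \<longlonglongrightarrow> 0"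
    using a by real_asymp
  moreover have "\<forall>\<^sub>F J in sequentially. \<bar>ln (norm w)\<bar> < \<tau> * m * real J"
    using A.\<tau> A.m by real_asymp
  then have "\<forall>\<^sub>F J in sequentially. norm (F w) \<le> C * exp (a * (real J)\<^sup>2 + K * real J)"
    by eventually_elim (rule key)
  ultimately have "norm (F w) \<le> 0"
    using tendsto_lowerbound trivial_limit_sequentially by blast
  then show ?thesis by simp
qed

section \<open>From lower density to blocks with equally many points\<close>

lemma lower_beurling_density_blocks:
  assumes dens: "lower_beurling_density \<Gamma> > ereal D" and "D > 0"
  obtains m \<delta> :: real and N :: nat where "m > 0" "\<delta> > 0" "D * m < N"
    and "\<And>x. \<exists>A. finite A \<and> card A = N \<and> A \<subseteq> \<Gamma> \<inter> {x + \<delta>..x + m - \<delta>}"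
proof -
  \<comment> \<open>The slack between \<open>D\<close> and \<open>y\<close> pays for the margin
    \<open>\<delta>\<close> around each window.\<close>
  obtain y where y: "ereal D < ereal y" "ereal y < lower_beurling_density \<Gamma>"
    using ereal_dense2[OF dens] by auto
  have "\<forall>\<^sub>F r in at_top. ereal y < (INF x\<in>(UNIV::real set). ereal (real (card (\<Gamma> \<inter> {x - r..x + r})) / (2 * r)))"
    using y(2) unfolding lower_beurling_density_def by (rule less_LiminfD)
  then have "\<forall>\<^sub>F r in at_top. r > 0 \<and>
      ereal y < (INF x\<in>(UNIV::real set). ereal (real (card (\<Gamma> \<inter> {x - r..x + r})) / (2 * r)))"
    using eventually_gt_at_top[of 0] by eventually_elim auto
  then obtain r :: real where r: "r > 0"
    and inf: "ereal y < (INF x\<in>(UNIV::real set). ereal (real (card (\<Gamma> \<inter> {x - r..x + r})) / (2 * r)))"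
    using eventually_happens'[OF trivial_limit_at_top_linorder] by blast
  have card: "2 * r * y < card (\<Gamma> \<inter> {x - r..x + r})" for x
    using less_INF_D[OF inf, of x] r by (simp add: field_simps)
  define N where "N = nat \<lceil>2 * r * y\<rceil>"
  \<comment> \<open>The block length lies between \<open>2r\<close> and \<open>2ry / D\<close>, which leaves a gap of width \<open>2\<delta>\<close> between
    the blocks and keeps \<open>D m < N\<close>.\<close>
  define m where "m = r + r * y / D"
  define \<delta> where "\<delta> = (m - 2 * r) / 2"
  have Dy: "D < y" using y by simp
  show thesis
  proof
    show "m > 0" using r Dy assms(2) by (simp add: m_def add_pos_pos)
    have "y / D > 1" using Dy assms(2) by simp
    then have "r * (y / D) > r * 1" using r by (intro mult_strict_left_mono) auto
    then show "\<delta> > 0" by (simp add: \<delta>_def m_def)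
    have "D * m = r * D + r * y" using assms(2) by (simp add: m_def field_simps)
    also have "\<dots> < 2 * r * y" using Dy r by simp
    also have "\<dots> \<le> N" unfolding N_def by linarith
    finally show "D * m < N" .
    fix x
    \<comment> \<open>The shortened block is exactly the window of radius \<open>r\<close> centred
      at \<open>x + m / 2\<close>, so the uniform count applies to it.\<close>
    have "x + m / 2 - r = x + \<delta>" "x + m / 2 + r = x + m - \<delta>"
      by (simp_all add: \<delta>_def field_simps)
    then have c: "2 * r * y < card (\<Gamma> \<inter> {x + \<delta>..x + m - \<delta>})" using card[of "x + m / 2"] by metis
    then have "N \<le> card (\<Gamma> \<inter> {x + \<delta>..x + m - \<delta>})" unfolding N_def by linarith
    then show "\<exists>A. finite A \<and> card A = N \<and> A \<subseteq> \<Gamma> \<inter> {x + \<delta>..x + m - \<delta>}"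
      by (metis obtain_subset_with_card_n)
  qed
qed

lemma holomorphic_eq_0_of_density:
  assumes F: "F holomorphic_on - {0}"
    and bound: "\<And>w. w \<noteq> 0 \<Longrightarrow> norm (F w) \<le> C * exp (\<kappa> * (ln (norm w))\<^sup>2)"
    and "\<tau> > 0" "\<kappa> > 0"
    and dens: "lower_beurling_density \<Gamma> > ereal (2 * \<kappa> * \<tau>)"
    and zeros: "\<And>\<gamma>. \<gamma> \<in> \<Gamma> \<Longrightarrow> F (of_real (exp (\<tau> * \<gamma>))) = 0"
    and "w \<noteq> 0"
  shows "F w = 0"
proof -
  obtain m \<delta> :: real and N :: nat where m: "m > 0" "\<delta> > 0" "2 * \<kappa> * \<tau> * m < N"
    and ex: "\<And>x. \<exists>A. finite A \<and> card A = N \<and> A \<subseteq> \<Gamma> \<inter> {x + \<delta>..x + m - \<delta>}"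
    using lower_beurling_density_blocks[OF dens] assms(3,4) by auto
  obtain X where X: "\<And>x. finite (X x)" "\<And>x. card (X x) = N" "\<And>x. X x \<subseteq> \<Gamma> \<inter> {x + \<delta>..x + m - \<delta>}"
    using ex by metis
  define A where "A i = X (m * real i)" for i
  \<comment> \<open>The block for the interval from \<open>- m * (i + 1)\<close> to
    \<open>- m * i\<close> is reflected at 0, which turns points of \<open>\<Gamma>\<close> on the
    negative half-line into positive exponents.\<close>
  define B where "B i = uminus ` X (- m * (real i + 1))" for i
  have "zero_blocks \<tau> m \<delta> N A"
  proof
    show "A i \<subseteq> {m * real i + \<delta>..m * real (i + 1) - \<delta>}" for i
      using X(3)[of "m * real i"] unfolding A_def by (auto simp: algebra_simps)
  qed (use assms m X in \<open>auto simp: A_def\<close>)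
  moreover have "zero_blocks \<tau> m \<delta> N B"
  proof
    show "B i \<subseteq> {m * real i + \<delta>..m * real (i + 1) - \<delta>}" for i
      using X(3)[of "- m * (real i + 1)"] unfolding B_def by (auto simp: algebra_simps)
  qed (use assms m X in \<open>auto simp: B_def card_image\<close>)
  moreover have "F (of_real (exp (\<tau> * \<gamma>))) = 0" if "\<gamma> \<in> A i" for \<gamma> i
    using that X(3) zeros unfolding A_def by blast
  moreover have "F (of_real (exp (- \<tau> * \<gamma>))) = 0" if "\<gamma> \<in> B i" for \<gamma> i
  proof -
    have "- \<gamma> \<in> \<Gamma>" using that X(3) unfolding B_def by fastforce
    then show ?thesis using zeros[of "- \<gamma>"] by simp
  qed
  ultimately show ?thesis
    using holomorphic_punctured_plane_eq_0[OF F bound] m(3) assms(7) by blast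
qed

section \<open>Gaussian Laurent series\<close>

text \<open>On the naturals \<open>n \<le> n\<^sup>2\<close> gives comparison with a geometric
  series; the negative half follows by symmetry.\<close>

lemma summable_on_exp_neg_square_int:
  fixes a :: real
  assumes "a > 0"
  shows "(\<lambda>k::int. exp (- a * (of_int k)\<^sup>2)) summable_on UNIV"
proof -
  let ?f = "\<lambda>k::int. exp (- a * (of_int k)\<^sup>2)"
  have nat: "(\<lambda>n::nat. exp (- a * (real n)\<^sup>2)) summable_on UNIV"
  proof (rule summable_on_comparison_test[of "\<lambda>n. exp (- a) ^ n"])
    show "(\<lambda>n. exp (- a) ^ n) summable_on UNIV"
      using assms by (subst summable_on_UNIV_nonneg_real_iff) (auto intro: summable_geometric)
    fix n :: nat
    have "real n \<le> (real n)\<^sup>2" by (cases n) (auto simp: power2_eq_square field_simps)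
    then have "a * real n \<le> a * (real n)\<^sup>2" using assms by simp
    then show "exp (- a * (real n)\<^sup>2) \<le> exp (- a) ^ n"
      by (simp add: exp_of_nat_mult[symmetric] mult.commute)
  qed auto
  have 1: "?f summable_on range int"
    using nat by (subst summable_on_reindex) (auto simp: o_def)
  have 2: "?f summable_on range (\<lambda>n. - int n)"
    using nat by (subst summable_on_reindex) (auto simp: o_def inj_on_def)
  \<comment> \<open>The index 0 belongs to both ranges and is removed from the second.\<close>
  have "?f summable_on (range int \<union> (range (\<lambda>n. - int n) - range int))"
    by (rule summable_on_Un_disjoint[OF 1 summable_on_subset_banach[OF 2]]) auto
  moreover have "range int \<union> (range (\<lambda>n. - int n) - range int) = UNIV"
    by (auto simp: image_iff) (metis int_cases2)
  ultimately show ?thesis by simp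
qed

text \<open>For constant coefficients 1 this is a Jacobi theta function. Only
  \<open>w \<noteq> 0\<close> matters, where bounded coefficients give absolute convergence.\<close>

definition gauss_laurent :: "real \<Rightarrow> (int \<Rightarrow> complex) \<Rightarrow> complex \<Rightarrow> complex" where
  "gauss_laurent a c w = (\<Sum>\<^sub>\<infinity>k. c k * of_real (exp (- a * (of_int k)\<^sup>2)) * w powi k)"

lemma norm_powi_exp:
  fixes w :: complex
  assumes "w \<noteq> 0"
  shows "norm (w powi k) = exp (of_int k * ln (norm w))"
  using assms by (simp add: norm_power_int powr_real_of_int'[symmetric] powr_def)

text \<open>The inequality \<open>\<bar>k\<bar> * R \<le> R\<^sup>2 / (2 * a) + a / 2 *
  k\<^sup>2\<close> spends half of the Gaussian decay on the power of \<open>w\<close>. The other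
  half is a summable majorant, uniform on annuli.\<close>

lemma norm_gauss_laurent_term_le:
  fixes c :: "int \<Rightarrow> complex" and w :: complex
  assumes "a > 0" "norm (c k) \<le> M" "w \<noteq> 0" "\<bar>ln (norm w)\<bar> \<le> R"
  shows "norm (c k * of_real (exp (- a * (of_int k)\<^sup>2)) * w powi k)
           \<le> M * exp (R\<^sup>2 / (2 * a)) * exp (- (a / 2) * (of_int k)\<^sup>2)"
proof -
  have "of_int k * ln (norm w) \<le> \<bar>of_int k\<bar> * \<bar>ln (norm w)\<bar>"
    by (metis abs_ge_self abs_mult)
  also have "\<dots> \<le> \<bar>of_int k\<bar> * R" using assms(4) by (intro mult_left_mono) auto
  also have "\<dots> \<le> R\<^sup>2 / (2 * a) + a / 2 * (of_int k)\<^sup>2"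
  proof -
    have "0 \<le> (R - a * \<bar>of_int k\<bar>)\<^sup>2 / (2 * a)" using assms(1) by simp
    also have "\<dots> = R\<^sup>2 / (2 * a) + a / 2 * (of_int k)\<^sup>2 - \<bar>of_int k\<bar> * R"
      using assms(1) by (simp add: power2_diff field_simps power_mult_distrib power2_eq_square)
    finally show ?thesis by simp
  qed
  finally have "- a * (of_int k)\<^sup>2 + of_int k * ln (norm w) \<le> R\<^sup>2 / (2 * a) + - (a / 2) * (of_int k)\<^sup>2"
    by (simp add: field_simps)
  then have "exp (- a * (of_int k)\<^sup>2 + of_int k * ln (norm w)) \<le> exp (R\<^sup>2 / (2 * a) + - (a / 2) * (of_int k)\<^sup>2)"
    by simp
  then have "norm (c k) * exp (- a * (of_int k)\<^sup>2 + of_int k * ln (norm w)) \<le> M * exp (R\<^sup>2 / (2 * a) + - (a / 2) * (of_int k)\<^sup>2)"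
    using assms(2) by (intro mult_mono) (auto intro: order_trans[OF norm_ge_zero])
  then show ?thesis
    unfolding norm_mult norm_powi_exp[OF assms(3)] exp_add by (simp add: mult.assoc)
qed

lemma gauss_laurent_abs_summable:
  assumes "a > 0" "bounded_seq c" "w \<noteq> 0"
  shows "(\<lambda>k. norm (c k * of_real (exp (- a * (of_int k)\<^sup>2)) * w powi k)) summable_on UNIV"
proof -
  obtain M where M: "\<And>k. norm (c k) \<le> M" using assms(2) by (auto simp: bounded_seq_def)
  show ?thesis
    by (rule summable_on_comparison_test
        [OF summable_on_cmult_right[OF summable_on_exp_neg_square_int[of "a/2"]]
            norm_gauss_laurent_term_le[OF assms(1) M assms(3) order_refl]])
       (use assms in auto)
qed

text \<open>Termwise differentiation with a locally uniform majorant. Each \<open>w powi k\<close>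
  contributes \<open>k * w powi k / w\<close>, which is why the derivative is again such a series,
  divided by \<open>w\<close>.\<close>

lemma gauss_laurent_differentiable:
  assumes "a > 0" "bounded_seq c" "w \<noteq> 0"
  shows "gauss_laurent a c field_differentiable at w"
    and "bounded_seq (\<lambda>k. of_int k * c k) \<Longrightarrow>
      (gauss_laurent a c has_field_derivative gauss_laurent a (\<lambda>k. of_int k * c k) w / w) (at w)"
proof -
  obtain M where M: "\<And>k. norm (c k) \<le> M" using assms(2) by (auto simp: bounded_seq_def)
  define t where "t k w = c k * of_real (exp (- a * (of_int k)\<^sup>2)) * w powi k" for k and w :: complex
  define t' where "t' k w = of_int k * c k * of_real (exp (- a * (of_int k)\<^sup>2)) * w powi k" for k and w :: complex
  have bij: "bij_betw int_decode UNIV UNIV" by (rule bij_int_decode)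
  \<comment> \<open>Absolute summability allows the integers to be enumerated, which links the
    unordered sum to an ordinary series.\<close>
  have sums_decode: "(\<lambda>n. f (int_decode n)) sums infsum f UNIV"
    if "(\<lambda>k. norm (f k)) summable_on UNIV" for f :: "int \<Rightarrow> complex"
  proof -
    have "(f has_sum infsum f UNIV) UNIV"
      using abs_summable_summable[OF that] by simp
    then have "((\<lambda>n. f (int_decode n)) has_sum infsum f UNIV) UNIV"
      by (simp add: has_sum_reindex_bij_betw[OF bij])
    then show ?thesis by (rule has_sum_imp_sums)
  qed
  have "\<exists>g g'. \<forall>x\<in>- {0}. (\<lambda>n. t (int_decode n) x) sums g x \<and>
      (\<lambda>n. t' (int_decode n) x / x) sums g' x \<and> (g has_field_derivative g' x) (at x)"
  proof (rule series_and_derivative_comparison_local)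
    show "open (- {0 :: complex})" by auto
  next
    fix n and x :: complex assume "x \<in> - {0}"
    then show "(t (int_decode n) has_field_derivative t' (int_decode n) x / x) (at x)"
      unfolding t_def t'_def by (auto intro!: derivative_eq_intros simp: power_int_diff)
  next
    fix x :: complex assume "x \<in> - {0}"
    then have x: "norm x > 0" by auto
    \<comment> \<open>\<open>R\<close> bounds \<open>\<bar>ln (norm y)\<bar>\<close> for all
      \<open>y\<close> with \<open>norm x / 2 \<le> norm y \<le> 2 * norm x\<close>, in particular
      on the ball of radius \<open>norm x / 2\<close>.\<close>
    define R where "R = \<bar>ln (norm x / 2)\<bar> + \<bar>ln (2 * norm x)\<bar>"
    define h where "h k = M * exp (R\<^sup>2 / (2 * a)) * exp (- (a / 2) * (of_int k)\<^sup>2)" for k :: int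
    have "h summable_on UNIV"
      unfolding h_def using assms by (intro summable_on_cmult_right summable_on_exp_neg_square_int) auto
    then have sm: "summable (\<lambda>n. h (int_decode n))"
      by (intro summable_on_imp_summable) (simp add: summable_on_reindex_bij_betw[OF bij])
    have "norm (t k y) \<le> h k" if "y \<in> ball x (norm x / 2)" for y k
    proof -
      have "norm x \<le> norm y + norm (x - y)"
        by (metis add.commute diff_add_cancel norm_triangle_ineq)
      moreover have "norm y \<le> norm x + norm (x - y)"
        by (metis add.commute diff_add_cancel norm_minus_commute norm_triangle_ineq)
      ultimately have y: "norm x / 2 \<le> norm y" "norm y \<le> 2 * norm x"
        using that by (auto simp: dist_norm)
      have y0: "norm y > 0" using y x by linarith
      then have "ln (norm x / 2) \<le> ln (norm y)" "ln (norm y) \<le> ln (2 * norm x)"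
        using y x by auto
      then have "\<bar>ln (norm y)\<bar> \<le> R" unfolding R_def by linarith
      then show ?thesis
        unfolding t_def h_def using y0 M assms(1) by (intro norm_gauss_laurent_term_le) auto
    qed
    then show "\<exists>d h. 0 < d \<and> summable h \<and>
      (\<forall>\<^sub>F n in sequentially. \<forall>y\<in>ball x d \<inter> - {0}. norm (t (int_decode n) y) \<le> h n)"
      using sm x by (intro exI[of _ "norm x / 2"] exI[of _ "\<lambda>n. h (int_decode n)"]) auto
  qed
  then obtain g g' where g: "\<And>x. x \<noteq> 0 \<Longrightarrow> (\<lambda>n. t (int_decode n) x) sums g x"
      "\<And>x. x \<noteq> 0 \<Longrightarrow> (\<lambda>n. t' (int_decode n) x / x) sums g' x"
      "\<And>x. x \<noteq> 0 \<Longrightarrow> (g has_field_derivative g' x) (at x)"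
    by (metis ComplI singletonD)
  have eq: "g x = gauss_laurent a c x" if "x \<noteq> 0" for x
    using sums_decode[of "\<lambda>k. t k x"] g(1)[OF that] gauss_laurent_abs_summable[OF assms(1,2) that]
    by (simp add: t_def gauss_laurent_def sums_unique2)
  have der: "(gauss_laurent a c has_field_derivative g' w) (at w)"
    using g(3)[OF assms(3)]
    by (rule has_field_derivative_transform_within_open[where S = "- {0}"]) (use assms eq in auto)
  then show "gauss_laurent a c field_differentiable at w"
    by (auto simp: field_differentiable_def)
  assume b: "bounded_seq (\<lambda>k. of_int k * c k)"
  have "g' w = gauss_laurent a (\<lambda>k. of_int k * c k) w / w"
    using sums_divide[OF sums_decode[of "\<lambda>k. t' k w"], of w] g(2)[OF assms(3)]
      gauss_laurent_abs_summable[OF assms(1) b assms(3)]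
    by (simp add: t'_def gauss_laurent_def sums_unique2)
  with der show "(gauss_laurent a c has_field_derivative gauss_laurent a (\<lambda>k. of_int k * c k) w / w) (at w)"
    by simp
qed

lemma gauss_laurent_holomorphic:
  assumes "a > 0" "bounded_seq c"
  shows "gauss_laurent a c holomorphic_on - {0}"
  using gauss_laurent_differentiable(1)[OF assms]
  by (auto simp: holomorphic_on_def field_differentiable_at_within)

text \<open>Completing the square, \<open>- a * k\<^sup>2 + k * s = s\<^sup>2 / (4 * a) - a * (k -
  t)\<^sup>2\<close> with \<open>t = s / (2 * a)\<close>, leaves a shifted Gaussian sum that is
  bounded uniformly in \<open>t\<close>. The cruder termwise estimate with \<open>2 * a\<close> in
  the denominator would double the density threshold.\<close>

lemma gauss_laurent_bound:
  assumes "a > 0" "bounded_seq c"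
  obtains C where "\<And>w. w \<noteq> 0 \<Longrightarrow> norm (gauss_laurent a c w) \<le> C * exp ((ln (norm w))\<^sup>2 / (4 * a))"
proof -
  obtain M where M: "\<And>k. norm (c k) \<le> M" using assms(2) by (auto simp: bounded_seq_def)
  define b where "b k = exp (- (a / 2) * (of_int k)\<^sup>2)" for k :: int
  have b: "b summable_on UNIV"
    unfolding b_def using assms(1) by (intro summable_on_exp_neg_square_int) simp
  show thesis
  proof
    fix w :: complex assume w: "w \<noteq> 0"
    define s where "s = ln (norm w)"
    define t where "t = s / (2 * a)"
    define K where "K = M * exp a * exp (s\<^sup>2 / (4 * a))"
    have term_le: "norm (c k * of_real (exp (- a * (of_int k)\<^sup>2)) * w powi k) \<le> K * b (k - \<lfloor>t\<rfloor>)" for k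
    proof -
      define j where "j = real_of_int (k - \<lfloor>t\<rfloor>)"
      define \<theta> where "\<theta> = t - \<lfloor>t\<rfloor>"
      have \<theta>: "0 \<le> \<theta>" "\<theta> \<le> 1" unfolding \<theta>_def by linarith+
      have kt: "real_of_int k - t = j - \<theta>" by (simp add: j_def \<theta>_def)
      \<comment> \<open>Comparing with the sum centred at the integer part of \<open>t\<close> makes the constant independent of \<open>w\<close>.\<close>
      have "(j - \<theta>)\<^sup>2 = j\<^sup>2 / 2 - \<theta>\<^sup>2 + (j - 2 * \<theta>)\<^sup>2 / 2"
        by (simp add: power2_eq_square field_simps)
      moreover have "\<theta>\<^sup>2 \<le> 1" using \<theta> by (simp add: power_le_one)
      ultimately have "(j - \<theta>)\<^sup>2 \<ge> j\<^sup>2 / 2 - 1"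
        using zero_le_power2[of "j - 2 * \<theta>"] by linarith
      then have "a * (j - \<theta>)\<^sup>2 \<ge> a * (j\<^sup>2 / 2 - 1)" using assms(1) by (intro mult_left_mono) auto
      moreover have "- a * (of_int k)\<^sup>2 + of_int k * s = s\<^sup>2 / (4 * a) - a * (of_int k - t)\<^sup>2"
        using assms(1) by (simp add: t_def power2_eq_square field_simps)
      ultimately have "- a * (of_int k)\<^sup>2 + of_int k * s \<le> a + s\<^sup>2 / (4 * a) + (- (a / 2) * j\<^sup>2)"
        unfolding kt by (simp add: right_diff_distrib)
      then have "exp (- a * (of_int k)\<^sup>2 + of_int k * s) \<le> exp (a + s\<^sup>2 / (4 * a) + (- (a / 2) * j\<^sup>2))"
        by simp
      then have "norm (c k) * exp (- a * (of_int k)\<^sup>2 + of_int k * s)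
          \<le> M * exp (a + s\<^sup>2 / (4 * a) + (- (a / 2) * j\<^sup>2))"
        using M[of k] by (intro mult_mono) (auto intro: order_trans[OF norm_ge_zero])
      then show ?thesis
        unfolding norm_mult norm_powi_exp[OF w] exp_add K_def b_def j_def s_def by (simp add: mult.assoc)
    qed
    have bij: "bij_betw (\<lambda>k::int. k - \<lfloor>t\<rfloor>) UNIV UNIV"
      by (rule bij_betwI[where g = "\<lambda>k. k + \<lfloor>t\<rfloor>"]) auto
    have "norm (gauss_laurent a c w) \<le> (\<Sum>\<^sub>\<infinity>k. norm (c k * of_real (exp (- a * (of_int k)\<^sup>2)) * w powi k))"
      unfolding gauss_laurent_def by (rule norm_infsum_bound[OF gauss_laurent_abs_summable[OF assms w]])
    also have "\<dots> \<le> (\<Sum>\<^sub>\<infinity>k. K * b (k - \<lfloor>t\<rfloor>))"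
      using b by (intro infsum_mono gauss_laurent_abs_summable[OF assms w] term_le summable_on_cmult_right)
        (simp add: summable_on_reindex_bij_betw[OF bij])
    also have "\<dots> = K * infsum b UNIV"
      by (simp add: infsum_cmult_right' infsum_reindex_bij_betw[OF bij])
    finally show "norm (gauss_laurent a c w) \<le> M * exp a * infsum b UNIV * exp ((ln (norm w))\<^sup>2 / (4 * a))"
      by (simp add: K_def s_def mult_ac)
  qed
qed

section \<open>Gaussian series on the real line as Laurent series on the positive half-line\<close>

lemma gauss_laurent_cnj:
  "gauss_laurent a (\<lambda>k. cnj (c k)) (of_real r) = cnj (gauss_laurent a c (of_real r))"
  unfolding gauss_laurent_def infsum_cnj[symmetric] by (simp add: of_real_power_int[symmetric] del: of_real_power_int)

text \<open>Expanding the square separates the factor \<open>exp (- lam * x\<^sup>2)\<close> from a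
  power of \<open>exp (2 * lam * \<beta> * x)\<close>.\<close>

lemma gauss_series_eq_laurent:
  "gauss_series lam \<beta> c x =
     of_real (exp (- lam * x\<^sup>2)) * gauss_laurent (lam * \<beta>\<^sup>2) c (of_real (exp (2 * lam * \<beta> * x)))"
proof -
  have "exp (- lam * (x - \<beta> * of_int k)\<^sup>2)
      = exp (- lam * x\<^sup>2) * (exp (- (lam * \<beta>\<^sup>2) * (of_int k)\<^sup>2) * exp (2 * lam * \<beta> * x) powi k)" for k
    by (simp add: exp_power_int power2_eq_square algebra_simps flip: exp_add)
  then show ?thesis
    unfolding gauss_series_def gauss_laurent_def infsum_cmult_right'[symmetric]
    by (intro infsum_cong) (simp add: mult_ac)
qed

text \<open>The series is the restriction to the real axis of an entire function \<open>F\<close>,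
  differentiated by the chain rule. The inner derivative \<open>2 * lam * \<beta> * w\<close>
  cancels the division by \<open>w\<close> in the derivative of the Laurent series.\<close>

lemma gauss_series_vector_derivative:
  assumes "lam > 0" "\<beta> > 0" "bounded_seq c" "bounded_seq (\<lambda>k. of_int k * c k)"
  defines "w \<equiv> \<lambda>x. complex_of_real (exp (2 * lam * \<beta> * x))"
  shows "vector_derivative (gauss_series lam \<beta> c) (at x) = of_real (exp (- lam * x\<^sup>2)) *
    (of_real (- 2 * lam * x) * gauss_laurent (lam * \<beta>\<^sup>2) c (w x)
      + of_real (2 * lam * \<beta>) * gauss_laurent (lam * \<beta>\<^sup>2) (\<lambda>k. of_int k * c k) (w x))"
proof -
  define a where "a = lam * \<beta>\<^sup>2"
  have a: "a > 0" using assms(1,2) by (simp add: a_def)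
  define F where "F z = exp (- of_real lam * z\<^sup>2) * gauss_laurent a c (exp (2 * of_real lam * of_real \<beta> * z))" for z :: complex
  have "gauss_series lam \<beta> c = (\<lambda>x. F (of_real x))"
    unfolding F_def gauss_series_eq_laurent a_def by (simp add: fun_eq_iff flip: exp_of_real)
  moreover
  have "(F has_field_derivative of_real (exp (- lam * x\<^sup>2)) *
    (of_real (- 2 * lam * x) * gauss_laurent a c (w x)
      + of_real (2 * lam * \<beta>) * gauss_laurent a (\<lambda>k. of_int k * c k) (w x))) (at (of_real x))"
    unfolding F_def
    by (rule derivative_eq_intros DERIV_chain2[OF gauss_laurent_differentiable(2)[OF a assms(3) _ assms(4)]] refl
        | simp)+
      (simp add: w_def algebra_simps flip: exp_of_real)
  then have "((\<lambda>x. F (of_real x)) has_vector_derivative of_real (exp (- lam * x\<^sup>2)) *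
    (of_real (- 2 * lam * x) * gauss_laurent a c (w x)
      + of_real (2 * lam * \<beta>) * gauss_laurent a (\<lambda>k. of_int k * c k) (w x))) (at x)"
    by (rule has_vector_derivative_real_field)
  ultimately show ?thesis
    unfolding a_def by (simp add: vector_derivative_at)
qed

section \<open>Functions with equal products and equal products of derivatives\<close>

text \<open>If \<open>g\<close> is nonzero somewhere, then \<open>f\<close> vanishes on the nonempty
  open set where \<open>g\<close> is nonzero, and hence on \<open>S\<close> by the identity
  theorem.\<close>

lemma holomorphic_mult_eq_0:
  assumes hol: "f holomorphic_on S" "g holomorphic_on S" and S: "open S" "connected S"
    and fg: "\<And>w. w \<in> S \<Longrightarrow> f w * g w = 0"
  shows "(\<forall>w\<in>S. f w = 0) \<or> (\<forall>w\<in>S. g w = 0)"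
proof (rule disjCI)
  assume "\<not> (\<forall>w\<in>S. g w = 0)"
  then obtain p where p: "p \<in> S" "g p \<noteq> 0" by blast
  define T where "T = S \<inter> g -` (- {0})"
  have "open T"
    unfolding T_def using hol(2) S(1)
    by (intro continuous_open_preimage holomorphic_on_imp_continuous_on) auto
  have T: "T \<subseteq> S" "T \<noteq> {}" using p by (auto simp: T_def)
  have "f w = 0" if "w \<in> T" for w
    using fg[of w] that by (auto simp: T_def)
  then show "\<forall>w\<in>S. f w = 0"
    using analytic_continuation_open[OF \<open>open T\<close> S(1) T(2) S(2) T(1) hol(1), of "\<lambda>_. 0"] by simp
qed

text \<open>Near \<open>p\<close> the quotient \<open>v / u\<close> has derivative 0 and is
  constant; the identity theorem extends the proportionality past the zeros of
  \<open>u\<close>.\<close>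

lemma proportional_of_wronskian_eq_0:
  assumes hol: "u holomorphic_on S" "v holomorphic_on S" and S: "open S" "connected S"
    and W: "\<And>w. w \<in> S \<Longrightarrow> deriv v w * u w = v w * deriv u w"
    and p: "p \<in> S" "u p \<noteq> 0" and w: "w \<in> S"
  shows "v w = v p / u p * u w"
proof -
  have "isCont u p"
    using hol(1) S(1) p(1) by (metis continuous_on_eq_continuous_at holomorphic_on_imp_continuous_on)
  then obtain e where e: "e > 0" "\<And>z. dist p z < e \<Longrightarrow> u z \<noteq> 0"
    using continuous_at_avoid[of p u 0] p(2) by auto
  obtain e' where e': "e' > 0" "ball p e' \<subseteq> S" using S(1) p(1) by (metis open_contains_ball)
  define B where "B = ball p (min e e')"
  have B: "open B" "convex B" "B \<subseteq> S" "p \<in> B" "\<And>z. z \<in> B \<Longrightarrow> u z \<noteq> 0"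
    using e e' by (auto simp: B_def)
  have "\<exists>k. \<forall>z\<in>B. v z / u z = k"
  proof (rule has_field_derivative_zero_constant[OF B(2)])
    fix x assume x: "x \<in> B"
    then have "x \<in> S" using B by blast
    have "(u has_field_derivative deriv u x) (at x)" "(v has_field_derivative deriv v x) (at x)"
      using hol S(1) \<open>x \<in> S\<close> by (auto intro: holomorphic_derivI)
    then have "((\<lambda>z. v z / u z) has_field_derivative
        (deriv v x * u x - v x * deriv u x) / (u x * u x)) (at x)"
      using B(5)[OF x] by (rule_tac DERIV_divide) auto
    then show "((\<lambda>z. v z / u z) has_field_derivative 0) (at x within B)"
      using W[OF \<open>x \<in> S\<close>] by (simp add: has_field_derivative_at_within)
  qed
  then have "v z = v p / u p * u z" if "z \<in> B" for z
    using that B(4,5) by (metis nonzero_divide_eq_eq)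
  moreover have "(\<lambda>z. v p / u p * u z) holomorphic_on S"
    by (intro holomorphic_intros hol)
  ultimately show ?thesis
    using analytic_continuation_open[OF B(1) S(1) _ S(2) B(3) hol(2) _ _ w] B(4) by blast
qed

text \<open>Here \<open>u'\<close> and \<open>v'\<close> are further functions, not derivatives.
  Expanding the product of the Wronskians of \<open>v\<close> with \<open>u\<close> and with
  \<open>u'\<close> leaves only \<open>u * u'\<close>, its derivative and
  \<open>deriv u * deriv u'\<close>. Replacing these by the corresponding expressions in
  \<open>v\<close> and \<open>v'\<close> makes everything cancel, so one of the two Wronskians
  vanishes identically.\<close>

lemma wronskian_dichotomy:
  assumes hol: "u holomorphic_on S" "u' holomorphic_on S" "v holomorphic_on S" "v' holomorphic_on S"
    and S: "open S" "connected S"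
    and eq: "\<And>w. w \<in> S \<Longrightarrow> u w * u' w = v w * v' w"
    and deq: "\<And>w. w \<in> S \<Longrightarrow> deriv u w * deriv u' w = deriv v w * deriv v' w"
  shows "(\<forall>w\<in>S. deriv v w * u w = v w * deriv u w) \<or> (\<forall>w\<in>S. deriv v w * u' w = v w * deriv u' w)"
proof -
  have "(deriv v w * u w - v w * deriv u w) * (deriv v w * u' w - v w * deriv u' w) = 0"
    if w: "w \<in> S" for w
  proof -
    have D: "(f has_field_derivative deriv f w) (at w)" if "f holomorphic_on S" for f
      using holomorphic_derivI[OF that S(1) w] .
    have 1: "((\<lambda>w. u w * u' w) has_field_derivative (deriv u w * u' w + deriv u' w * u w)) (at w)"
      by (rule DERIV_mult[OF D D]) (fact hol)+
    have 2: "((\<lambda>w. v w * v' w) has_field_derivative (deriv v w * v' w + deriv v' w * v w)) (at w)"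
      by (rule DERIV_mult[OF D D]) (fact hol)+
    have "((\<lambda>w. u w * u' w) has_field_derivative (deriv v w * v' w + deriv v' w * v w)) (at w)"
      by (rule has_field_derivative_transform_within_open[OF 2 S(1) w]) (simp add: eq)
    with 1 have "deriv u w * u' w + deriv u' w * u w = deriv v w * v' w + deriv v' w * v w"
      by (rule DERIV_unique)
    then show ?thesis
      using eq[OF w] deq[OF w] by algebra
  qed
  then have "(\<forall>w\<in>S. deriv v w * u w - v w * deriv u w = 0) \<or> (\<forall>w\<in>S. deriv v w * u' w - v w * deriv u' w = 0)"
    using S hol by (intro holomorphic_mult_eq_0) (auto intro!: holomorphic_intros)
  then show ?thesis by simp
qed

section \<open>Phaseless samples\<close>

text \<open>The left side is holomorphic off 0 as a function of a complex variable when
  \<open>a > 0\<close> and \<open>c\<close> is bounded, so it is the substitute for the squared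
  modulus to which a uniqueness theorem applies.\<close>

lemma gauss_laurent_mult_cnj:
  "gauss_laurent a c (of_real r) * gauss_laurent a (\<lambda>k. cnj (c k)) (of_real r)
     = of_real ((norm (gauss_laurent a c (of_real r)))\<^sup>2)"
  unfolding gauss_laurent_cnj complex_norm_square ..

lemma gauss_laurent_mult_bound:
  assumes "a > 0" "bounded_seq c" "bounded_seq d"
  obtains C where "\<And>w. w \<noteq> 0 \<Longrightarrow>
    norm (gauss_laurent a c w * gauss_laurent a d w) \<le> C * exp (1 / (2 * a) * (ln (norm w))\<^sup>2)"
proof -
  obtain C where C: "\<And>w. w \<noteq> 0 \<Longrightarrow> norm (gauss_laurent a c w) \<le> C * exp ((ln (norm w))\<^sup>2 / (4 * a))"
    using gauss_laurent_bound[OF assms(1,2)] by blast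
  obtain D where D: "\<And>w. w \<noteq> 0 \<Longrightarrow> norm (gauss_laurent a d w) \<le> D * exp ((ln (norm w))\<^sup>2 / (4 * a))"
    using gauss_laurent_bound[OF assms(1,3)] by blast
  show thesis
  proof
    fix w :: complex assume w: "w \<noteq> 0"
    have "norm (gauss_laurent a c w * gauss_laurent a d w)
        \<le> (C * exp ((ln (norm w))\<^sup>2 / (4 * a))) * (D * exp ((ln (norm w))\<^sup>2 / (4 * a)))"
      unfolding norm_mult using C[OF w] D[OF w] by (intro mult_mono) (auto intro: order_trans[OF norm_ge_zero])
    also have "\<dots> = C * D * exp ((ln (norm w))\<^sup>2 / (4 * a) + (ln (norm w))\<^sup>2 / (4 * a))"
      unfolding exp_add by (simp only: mult_ac)
    also have "(ln (norm w))\<^sup>2 / (4 * a) + (ln (norm w))\<^sup>2 / (4 * a) = 1 / (2 * a) * (ln (norm w))\<^sup>2"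
      using assms(1) by (simp add: field_simps)
    finally show "norm (gauss_laurent a c w * gauss_laurent a d w) \<le> C * D * exp (1 / (2 * a) * (ln (norm w))\<^sup>2)" .
  qed
qed

lemma bounded_seq_cnj: "bounded_seq c \<Longrightarrow> bounded_seq (\<lambda>k. cnj (c k))"
  by (simp add: bounded_seq_def)

lemma gauss_laurent_modulus_determined:
  assumes "\<beta> > 0" "lam > 0" and dens: "lower_beurling_density \<Gamma> > ereal (2 / \<beta>)"
    and c: "bounded_seq c" and d: "bounded_seq d"
    and eq: "\<And>\<gamma>. \<gamma> \<in> \<Gamma> \<Longrightarrow>
      norm (gauss_laurent (lam * \<beta>\<^sup>2) c (of_real (exp (2 * lam * \<beta> * \<gamma>))))
      = norm (gauss_laurent (lam * \<beta>\<^sup>2) d (of_real (exp (2 * lam * \<beta> * \<gamma>))))"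
    and "w \<noteq> 0"
  shows "gauss_laurent (lam * \<beta>\<^sup>2) c w * gauss_laurent (lam * \<beta>\<^sup>2) (\<lambda>k. cnj (c k)) w
    = gauss_laurent (lam * \<beta>\<^sup>2) d w * gauss_laurent (lam * \<beta>\<^sup>2) (\<lambda>k. cnj (d k)) w"
proof -
  define a where "a = lam * \<beta>\<^sup>2"
  have a: "a > 0" using assms(1,2) by (simp add: a_def)
  let ?P = "\<lambda>c w. gauss_laurent a c w * gauss_laurent a (\<lambda>k. cnj (c k)) w"
  define F where "F w = ?P c w - ?P d w" for w
  obtain C D where C: "\<And>w. w \<noteq> 0 \<Longrightarrow> norm (?P c w) \<le> C * exp (1 / (2 * a) * (ln (norm w))\<^sup>2)"
    and D: "\<And>w. w \<noteq> 0 \<Longrightarrow> norm (?P d w) \<le> D * exp (1 / (2 * a) * (ln (norm w))\<^sup>2)"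
    using gauss_laurent_mult_bound[OF a c bounded_seq_cnj[OF c]]
      gauss_laurent_mult_bound[OF a d bounded_seq_cnj[OF d]] by metis
  have "F w = 0"
  proof (rule holomorphic_eq_0_of_density[where F = F and w = w and \<Gamma> = \<Gamma> and \<kappa> = "1 / (2 * a)" and \<tau> = "2 * lam * \<beta>"
        and C = "C + D"])
    show "F holomorphic_on - {0}"
      unfolding F_def
      by (intro holomorphic_intros gauss_laurent_holomorphic a c d bounded_seq_cnj)
    show "norm (F w) \<le> (C + D) * exp (1 / (2 * a) * (ln (norm w))\<^sup>2)" if "w \<noteq> 0" for w
      unfolding F_def distrib_right
      by (rule order_trans[OF norm_triangle_ineq4]) (rule add_mono[OF C[OF that] D[OF that]])
    \<comment> \<open>The growth rate \<open>1 / (2 * a)\<close> of the product and the scale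
      \<open>2 * lam * \<beta>\<close> of the sample points combine to exactly the density threshold
      \<open>2 / \<beta>\<close>.\<close>
    have "2 * (1 / (2 * a)) * (2 * lam * \<beta>) = 2 / \<beta>"
      using assms(1,2) by (simp add: a_def power2_eq_square field_simps)
    then show "ereal (2 * (1 / (2 * a)) * (2 * lam * \<beta>)) < lower_beurling_density \<Gamma>"
      using dens by (simp only:)
    show "F (of_real (exp (2 * lam * \<beta> * \<gamma>))) = 0" if "\<gamma> \<in> \<Gamma>" for \<gamma>
      using eq[OF that] unfolding F_def gauss_laurent_mult_cnj a_def by simp
  qed (use assms a in auto)
  then show ?thesis by (simp add: F_def a_def)
qed

theorem theorem3p1:
  fixes \<beta> lam :: real and \<Gamma> :: "real set" and c d :: "int \<Rightarrow> complex"
  assumes "\<beta> > 0" and "lam > 0"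
    and "separated \<Gamma>"
    and "lower_beurling_density \<Gamma> > ereal (2 / \<beta>)"
    and "bounded_seq c" and "bounded_seq (\<lambda>k. of_int k * c k)"
    and "bounded_seq d" and "bounded_seq (\<lambda>k. of_int k * d k)"
    and "\<forall>\<gamma>\<in>\<Gamma>. norm (gauss_series lam \<beta> d \<gamma>) = norm (gauss_series lam \<beta> c \<gamma>)"
    and "\<forall>\<gamma>\<in>\<Gamma>. norm (vector_derivative (gauss_series lam \<beta> d) (at \<gamma>))
                 = norm (vector_derivative (gauss_series lam \<beta> c) (at \<gamma>))"
  shows "\<exists>z::complex. norm z = 1 \<and>
           ((\<forall>x. gauss_series lam \<beta> d x = z * gauss_series lam \<beta> c x) \<or>
            (\<forall>x. gauss_series lam \<beta> d x = z * cnj (gauss_series lam \<beta> c x)))"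
proof -
  define a where "a = lam * \<beta>\<^sup>2"
  have a: "a > 0" using assms(1,2) by (simp add: a_def)
  define \<tau> where "\<tau> = 2 * lam * \<beta>"
  have \<tau>: "\<tau> > 0" using assms(1,2) by (simp add: \<tau>_def)
  define e where "e x = complex_of_real (exp (\<tau> * x))" for x
  have e0: "e x \<noteq> 0" for x by (simp add: e_def)
  define L where "L = gauss_laurent a"
  define conj where "conj c = (\<lambda>k::int. cnj (c k))" for c
  define k_times where "k_times c = (\<lambda>k::int. of_int k * c k :: complex)" for c
  \<comment> \<open>The multipliers \<open>k\<close> are real, so they commute with conjugation of
    the coefficients.\<close>
  have swap: "k_times (conj c) = conj (k_times c)" for c by (auto simp: k_times_def conj_def)
  have b: "bounded_seq c" "bounded_seq (k_times c)" "bounded_seq d" "bounded_seq (k_times d)"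
    using assms(5-8) by (simp_all add: k_times_def)
  have bc: "bounded_seq (conj c)" if "bounded_seq c" for c
    using bounded_seq_cnj[OF that] by (simp add: conj_def)
  have hol: "L c holomorphic_on - {0}" if "bounded_seq c" for c
    unfolding L_def by (rule gauss_laurent_holomorphic[OF a that])
  have der: "(L c has_field_derivative L (k_times c) w / w) (at w)"
    if "bounded_seq c" "bounded_seq (k_times c)" "w \<noteq> 0" for c w
    using gauss_laurent_differentiable(2)[OF a that(1,3)] that(2) by (simp add: L_def k_times_def)
  have cnj_L: "L (conj c) (e x) = cnj (L c (e x))" for c x
    by (simp add: L_def conj_def e_def gauss_laurent_cnj)
  have series: "gauss_series lam \<beta> c x = of_real (exp (- lam * x\<^sup>2)) * L c (e x)" for c x
    by (simp only: gauss_series_eq_laurent L_def e_def a_def \<tau>_def)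
  have vder: "vector_derivative (gauss_series lam \<beta> c) (at x) = of_real (exp (- lam * x\<^sup>2)) *
      (of_real (- 2 * lam * x) * L c (e x) + of_real \<tau> * L (k_times c) (e x))"
    if "bounded_seq c" "bounded_seq (k_times c)" for c x
    using gauss_series_vector_derivative[OF assms(2,1) that(1)] that(2)
    unfolding L_def e_def a_def \<tau>_def k_times_def by blast
  have determined: "L c w * L (conj c) w = L d w * L (conj d) w"
    if "bounded_seq c" "bounded_seq d" "w \<noteq> 0"
      "\<And>\<gamma>. \<gamma> \<in> \<Gamma> \<Longrightarrow> norm (L c (e \<gamma>)) = norm (L d (e \<gamma>))" for c d w
    using gauss_laurent_modulus_determined[OF assms(1,2,4) that(1,2) _ that(3)] that(4)
    unfolding L_def conj_def e_def a_def \<tau>_def by blast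

  have mod: "L c w * L (conj c) w = L d w * L (conj d) w" if "w \<noteq> 0" for w
  proof (rule determined[OF b(1,3) that])
    show "norm (L c (e \<gamma>)) = norm (L d (e \<gamma>))" if "\<gamma> \<in> \<Gamma>" for \<gamma>
      using assms(9) that unfolding series norm_mult by simp
  qed
  \<comment> \<open>This is \<open>mod\<close> differentiated and multiplied by \<open>w\<close>; on
    the positive half-line both sides are twice the real part of the cross term.\<close>
  have cross: "L (k_times c) w * L (conj c) w + L c w * L (conj (k_times c)) w
      = L (k_times d) w * L (conj d) w + L d w * L (conj (k_times d)) w" if w: "w \<noteq> 0" for w
  proof -
    have D: "((\<lambda>w. L c w * L (conj c) w) has_field_derivative
        (L (k_times c) w * L (conj c) w + L c w * L (conj (k_times c)) w) / w) (at w)"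
      if "bounded_seq c" "bounded_seq (k_times c)" for c
      using DERIV_mult[OF der[OF that w] der[OF bc[OF that(1)], of w]] bc[OF that(2)] w
      by (simp add: swap add_divide_distrib mult.commute)
    have "((\<lambda>w. L c w * L (conj c) w) has_field_derivative
        (L (k_times d) w * L (conj d) w + L d w * L (conj (k_times d)) w) / w) (at w)"
      by (rule has_field_derivative_transform_within_open[OF D[OF b(3,4)], where S = "- {0}"])
        (use w mod in auto)
    from DERIV_unique[OF D[OF b(1,2)] this] show ?thesis using w by simp
  qed
  have mod': "L (k_times c) w * L (conj (k_times c)) w = L (k_times d) w * L (conj (k_times d)) w"
    if "w \<noteq> 0" for w
  proof (rule determined[OF b(2,4) that])
    fix \<gamma> assume \<gamma>: "\<gamma> \<in> \<Gamma>"
    let ?U = "L c (e \<gamma>)" and ?U' = "L (k_times c) (e \<gamma>)"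
    let ?V = "L d (e \<gamma>)" and ?V' = "L (k_times d) (e \<gamma>)"
    \<comment> \<open>After removal of the Gaussian factor, the derivative at
      \<open>\<gamma>\<close> is \<open>x * ?U + t * ?U'\<close> with real \<open>x\<close> and
      \<open>t\<close>.\<close>
    define x where "x = complex_of_real (- 2 * lam * \<gamma>)"
    define t where "t = complex_of_real \<tau>"
    have t: "t \<noteq> 0" "cnj t = t" "cnj x = x" using \<tau> by (auto simp: t_def x_def)
    have "norm (x * ?V + t * ?V') = norm (x * ?U + t * ?U')"
      using assms(10) \<gamma> unfolding vder[OF b(1,2)] vder[OF b(3,4)] norm_mult x_def t_def by simp
    then have "(x * ?V + t * ?V') * cnj (x * ?V + t * ?V') = (x * ?U + t * ?U') * cnj (x * ?U + t * ?U')"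
      by (simp only: complex_norm_square[symmetric])
    then have "(x * ?V + t * ?V') * (x * cnj ?V + t * cnj ?V') = (x * ?U + t * ?U') * (x * cnj ?U + t * cnj ?U')"
      by (simp add: t)
    moreover have "?U * cnj ?U = ?V * cnj ?V" "?U' * cnj ?U + ?U * cnj ?U' = ?V' * cnj ?V + ?V * cnj ?V'"
      using mod[OF e0] cross[OF e0] by (simp_all add: cnj_L)
    \<comment> \<open>With \<open>p\<close>, \<open>q\<close> the values of a series and of its
      \<open>k_times\<close> series, and \<open>p'\<close>, \<open>q'\<close> their conjugates, the
      identity isolates the squared modulus of \<open>q\<close> from the sampled quantity,
      \<open>mod\<close> and \<open>cross\<close>.\<close>
    moreover have "t * t * (q * q') = (x * p + t * q) * (x * p' + t * q') - x * x * (p * p') - x * t * (q * p' + p * q')"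
      for p q p' q' :: complex
      by (simp add: algebra_simps)
    ultimately have "t * t * (?U' * cnj ?U') = t * t * (?V' * cnj ?V')"
      by metis
    then have "?U' * cnj ?U' = ?V' * cnj ?V'" using t(1) by simp
    then have "(norm ?U')\<^sup>2 = (norm ?V')\<^sup>2"
      by (metis complex_norm_square of_real_eq_iff)
    then show "norm ?U' = norm ?V'" by simp
  qed

  have normeq: "norm (L c (e x)) = norm (L d (e x))" for x
  proof -
    have "(norm (L c (e x)))\<^sup>2 = (norm (L d (e x)))\<^sup>2"
      using mod[OF e0, of x] by (metis cnj_L complex_norm_square of_real_eq_iff)
    then show ?thesis by simp
  qed
  show ?thesis
  proof (cases "\<forall>x. L c (e x) = 0")
    case True
    \<comment> \<open>Both functions vanish identically, so any unimodular constant would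
      do.\<close>
    then have "\<forall>x. L d (e x) = 0" using normeq by (metis norm_eq_zero)
    with True show ?thesis by (intro exI[of _ 1]) (simp add: series)
  next
    case False
    then obtain p where p: "L c (e p) \<noteq> 0" by blast
    have S: "open (- {0 :: complex})" "connected (- {0 :: complex})"
      by (auto intro: connected_punctured_universe)
    have dL: "deriv (L c) w = L (k_times c) w / w"
      if "bounded_seq c" "bounded_seq (k_times c)" "w \<noteq> 0" for c w
      using DERIV_imp_deriv[OF der[OF that]] .
    have "(\<forall>w\<in>- {0}. deriv (L d) w * L c w = L d w * deriv (L c) w) \<or>
        (\<forall>w\<in>- {0}. deriv (L d) w * L (conj c) w = L d w * deriv (L (conj c)) w)"
    proof (rule wronskian_dichotomy[OF _ _ _ _ S])
      fix w :: complex assume "w \<in> - {0}"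
      then have w: "w \<noteq> 0" by simp
      show "deriv (L c) w * deriv (L (conj c)) w = deriv (L d) w * deriv (L (conj d)) w"
        using mod'[OF w] dL[OF _ _ w] b bc by (simp add: swap)
    qed (use hol b bc mod in auto)
    then show ?thesis
    proof
      assume W: "\<forall>w\<in>- {0}. deriv (L d) w * L c w = L d w * deriv (L c) w"
      \<comment> \<open>The ratio is taken at a point of the positive half-line, where
        \<open>normeq\<close> makes it unimodular.\<close>
      define z where "z = L d (e p) / L c (e p)"
      have "L d (e x) = z * L c (e x)" for x
        unfolding z_def
        by (rule proportional_of_wronskian_eq_0[OF hol hol S]) (use W b p e0 in auto)
      moreover have "norm z = 1" using p normeq[of p] by (auto simp: z_def norm_divide)
      ultimately show ?thesis by (intro exI[of _ z]) (simp add: series)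
    next
      assume W: "\<forall>w\<in>- {0}. deriv (L d) w * L (conj c) w = L d w * deriv (L (conj c)) w"
      \<comment> \<open>On the positive half-line \<open>L (conj c)\<close> is the conjugate of
        \<open>L c\<close>, so it is nonzero at \<open>e p\<close> with the same modulus, and this
        alternative yields the conjugate function.\<close>
      define z where "z = L d (e p) / L (conj c) (e p)"
      have "L d (e x) = z * L (conj c) (e x)" for x
        unfolding z_def
        by (rule proportional_of_wronskian_eq_0[OF hol hol S]) (use W b bc p e0 in \<open>auto simp: cnj_L\<close>)
      moreover have "norm z = 1" using p normeq[of p] by (auto simp: z_def norm_divide cnj_L)
      ultimately show ?thesis by (intro exI[of _ z]) (simp add: series cnj_L)
    qed
  qed
qed

end
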